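(* Let $\epsilon>0$ and let $(G_n)$ be a sequence of graphs, where $G_n$ is $k_n$-regular on $v_n$ vertices with $k_n>\epsilon v_n$. Assume that each group $X_n=\mathrm{Aut}(G_n)$ is a primitive permutation group on the vertex set of $G_n$, and that the index in $X_n$ of the largest abelian normal subgroup of $X_n$ tends to infinity. Then $\Lambda(G_n)=o(k_n)$.
   Context: For a $k$-regular graph $G$ on $v$ vertices with adjacency eigenvalues $k=\lambda_1\ge\lambda_2\ge\dots\ge\lambda_v$, $\Lambda(G)=\max\{|\lambda_i| : 2\le i\le v\}$. A permutation group on a set $\Omega$ is primitive if it is transitive and preserves no non-trivial partition of $\Omega$. For a primitive permutation group the largest abelian normal subgroup is unique. *)

theory Defs
  imports "Jordan_Normal_Form.Char_Poly" "HOL-Algebra.Coset" "HOL-Library.Landau_Symbols"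
    "HOL-Combinatorics.Permutations"
begin

text \<open>A finite simple graph on vertex set {0..<v} given by an adjacency relation E
  (only its values on vertices below v matter).\<close>
definition simple_graph :: "nat \<Rightarrow> (nat \<Rightarrow> nat \<Rightarrow> bool) \<Rightarrow> bool" where
  "simple_graph v E \<longleftrightarrow> (\<forall>x<v. \<forall>y<v. E x y = E y x) \<and> (\<forall>x<v. \<not> E x x)"

definition regular_graph :: "nat \<Rightarrow> (nat \<Rightarrow> nat \<Rightarrow> bool) \<Rightarrow> nat \<Rightarrow> bool" where
  "regular_graph v E k \<longleftrightarrow> (\<forall>x<v. card {y. y < v \<and> E x y} = k)"

definition adj_matrix :: "nat \<Rightarrow> (nat \<Rightarrow> nat \<Rightarrow> bool) \<Rightarrow> real mat" where
  "adj_matrix v E = mat v v (\<lambda>(i, j). if E i j then 1 else 0)"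

text \<open>Multiset of adjacency eigenvalues (with multiplicity): roots of the characteristic
  polynomial; the matrix is real symmetric, so all roots are real.\<close>
definition adj_eigenvalues :: "nat \<Rightarrow> (nat \<Rightarrow> nat \<Rightarrow> bool) \<Rightarrow> real multiset" where
  "adj_eigenvalues v E = proots (char_poly (adj_matrix v E))"

text \<open>Lambda(G) = max |lambda_i| over i >= 2, i.e. over the eigenvalue multiset with one
  copy of the largest eigenvalue lambda_1 = k removed (0 if nothing remains).\<close>
definition Lambda :: "nat \<Rightarrow> (nat \<Rightarrow> nat \<Rightarrow> bool) \<Rightarrow> real" where
  "Lambda v E = (let M = adj_eigenvalues v E;
                     M' = M - {# Max (set_mset M) #}
                 in if M' = {#} then 0 else Max (abs ` set_mset M'))"

definition graph_automorphisms :: "nat \<Rightarrow> (nat \<Rightarrow> nat \<Rightarrow> bool) \<Rightarrow> (nat \<Rightarrow> nat) set" where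
  "graph_automorphisms v E =
     {p. p permutes {..<v} \<and> (\<forall>x<v. \<forall>y<v. E (p x) (p y) = E x y)}"

definition Aut :: "nat \<Rightarrow> (nat \<Rightarrow> nat \<Rightarrow> bool) \<Rightarrow> (nat \<Rightarrow> nat) monoid" where
  "Aut v E = \<lparr>carrier = graph_automorphisms v E, mult = (\<circ>), one = id\<rparr>"

definition transitive_on :: "(nat \<Rightarrow> nat) set \<Rightarrow> nat set \<Rightarrow> bool" where
  "transitive_on P \<Omega> \<longleftrightarrow> (\<forall>x\<in>\<Omega>. \<forall>y\<in>\<Omega>. \<exists>g\<in>P. g x = y)"

definition is_partition :: "nat set set \<Rightarrow> nat set \<Rightarrow> bool" where
  "is_partition Q \<Omega> \<longleftrightarrow> \<Union>Q = \<Omega> \<and> {} \<notin> Q \<and>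
      (\<forall>A\<in>Q. \<forall>B\<in>Q. A \<noteq> B \<longrightarrow> A \<inter> B = {})"

definition primitive_on :: "(nat \<Rightarrow> nat) set \<Rightarrow> nat set \<Rightarrow> bool" where
  "primitive_on P \<Omega> \<longleftrightarrow> transitive_on P \<Omega> \<and>
     (\<forall>Q. is_partition Q \<Omega> \<and> (\<forall>g\<in>P. \<forall>B\<in>Q. g ` B \<in> Q) \<longrightarrow>
          Q = {\<Omega>} \<or> Q = (\<lambda>x. {x}) ` \<Omega>)"

definition abelian_normal_subgroup :: "('a, 'b) monoid_scheme \<Rightarrow> 'a set \<Rightarrow> bool" where
  "abelian_normal_subgroup G A \<longleftrightarrow> normal A G \<and>
     (\<forall>x\<in>A. \<forall>y\<in>A. x \<otimes>\<^bsub>G\<^esub> y = y \<otimes>\<^bsub>G\<^esub> x)"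

definition index_largest_abelian_normal :: "('a, 'b) monoid_scheme \<Rightarrow> nat" where
  "index_largest_abelian_normal G =
     order G div Max (card ` {A. abelian_normal_subgroup G A})"

end

theory Submission
  imports Defs "HOL-Analysis.L2_Norm" "HOL-Library.FuncSet"
begin

text \<open>Since the squares of the eigenvalues sum to \<open>v k\<close>, an eigenvalue of modulus at least \<open>c k\<close> in a
  graph with \<open>k > \<epsilon> v\<close> has an eigenspace of dimension at most \<open>1 / (c\<^sup>2 \<epsilon>)\<close>. The automorphism group
  acts orthogonally on it. The kernel is a normal subgroup of a primitive group, hence trivial or
  transitive, and it cannot be transitive when the eigenspace contains a nonconstant function. So
  the group embeds into an orthogonal group of bounded dimension, and by Jordan's theorem it has an
  abelian normal subgroup of bounded index. For primitive groups Jordan's theorem has a short proof: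
  commutators of elements close to the identity are closer still, so a nontrivial element closest
  to the identity commutes with all elements near the identity; and in a primitive group a normal
  subgroup with nontrivial centre is abelian, because its centre is transitive.\<close>

section \<open>Normal subgroups of primitive permutation groups\<close>

text \<open>HOL-Algebra claims the notation \<open>inv\<close> for inverses in a group.\<close>
abbreviation pinv :: "('a \<Rightarrow> 'b) \<Rightarrow> 'b \<Rightarrow> 'a" where
  "pinv \<equiv> inv_into UNIV"

locale permutation_group =
  fixes P :: "(nat \<Rightarrow> nat) set" and \<Omega> :: "nat set"
  assumes finite_domain: "finite \<Omega>"
    and permutes: "g \<in> P \<Longrightarrow> g permutes \<Omega>"
    and id_closed: "id \<in> P"
    and comp_closed: "g \<in> P \<Longrightarrow> h \<in> P \<Longrightarrow> g \<circ> h \<in> P"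
    and inv_closed: "g \<in> P \<Longrightarrow> pinv g \<in> P"
begin

lemma finite_group: "finite P"
  using finite_subset[OF _ finite_permutations[OF finite_domain]] permutes by blast

lemma bij: "g \<in> P \<Longrightarrow> bij g"
  using permutes permutes_bij by blast

lemma inv_apply [simp]: "g \<in> P \<Longrightarrow> pinv g (g x) = x" "g \<in> P \<Longrightarrow> g (pinv g x) = x"
  using permutes permutes_inverses by metis+

lemma comp_inv: "g \<in> P \<Longrightarrow> g \<circ> pinv g = id" "g \<in> P \<Longrightarrow> pinv g \<circ> g = id"
  by (auto simp: fun_eq_iff)

lemma inv_inv: "g \<in> P \<Longrightarrow> pinv (pinv g) = g"
  using bij inv_inv_eq by blast

lemma in_domain_iff: "g \<in> P \<Longrightarrow> g x \<in> \<Omega> \<longleftrightarrow> x \<in> \<Omega>"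
  using permutes permutes_in_image by metis

lemma fixes_outside: "g \<in> P \<Longrightarrow> x \<notin> \<Omega> \<Longrightarrow> g x = x"
  using permutes permutes_not_in by metis

text \<open>Normality is phrased through bare composition and \<open>pinv\<close>, so that kernels
  and centralizers can be treated as plain sets of functions. The passage to \<open>normal\<close>
  in HOL-Algebra is made once, in \<open>index_largest_abelian_normal_le\<close>.\<close>

definition normal_in :: "(nat \<Rightarrow> nat) set \<Rightarrow> bool" where
  "normal_in N \<longleftrightarrow> N \<subseteq> P \<and> id \<in> N \<and> (\<forall>a\<in>N. \<forall>b\<in>N. a \<circ> b \<in> N) \<and> (\<forall>a\<in>N. pinv a \<in> N) \<and>
     (\<forall>g\<in>P. \<forall>a\<in>N. g \<circ> a \<circ> pinv g \<in> N)"

text \<open>Because N is normal, P permutes the orbits of N, so they form an invariant partition.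
  Primitivity leaves a single orbit or only singletons, and \<open>n\<^sub>0\<close> moves some
  point.\<close>

lemma primitive_normal_transitive:
  assumes prim: "primitive_on P \<Omega>" and N: "normal_in N" and nontriv: "n\<^sub>0 \<in> N" "n\<^sub>0 \<noteq> id"
  shows "transitive_on N \<Omega>"
proof -
  define orbit where "orbit x = (\<lambda>n. n x) ` N" for x
  define Q where "Q = orbit ` \<Omega>"
  have NP: "n \<in> P" if "n \<in> N" for n using N that by (auto simp: normal_in_def)
  have self: "x \<in> orbit x" for x
    using N by (auto simp: orbit_def normal_in_def intro!: image_eqI[of _ _ id])
  have orbit_sub: "orbit (n x) \<subseteq> orbit x" if "n \<in> N" for n x
    using N that by (auto simp: orbit_def normal_in_def intro!: image_eqI[of _ _ "_ \<circ> n"])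
  have orbit_eq: "orbit (n x) = orbit x" if "n \<in> N" for n x
  proof
    have "pinv n \<in> N" using N that by (auto simp: normal_in_def)
    from orbit_sub[OF this, of "n x"] show "orbit x \<subseteq> orbit (n x)"
      using NP[OF that] by simp
  qed (rule orbit_sub[OF that])
  have part: "is_partition Q \<Omega>"
    unfolding is_partition_def
  proof (intro conjI ballI impI)
    show "\<Union> Q = \<Omega>"
      using self NP in_domain_iff by (auto simp: Q_def orbit_def)
    show "{} \<notin> Q" using self by (auto simp: Q_def)
    fix A B assume AB: "A \<in> Q" "B \<in> Q" "A \<noteq> B"
    then obtain x y where xy: "A = orbit x" "B = orbit y" by (auto simp: Q_def)
    show "A \<inter> B = {}"
    proof (rule ccontr)
      assume "A \<inter> B \<noteq> {}"
      then obtain n m where "n \<in> N" "m \<in> N" "n x = m y"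
        unfolding xy by (auto simp: orbit_def)
      then show False using orbit_eq AB(3) unfolding xy by metis
    qed
  qed
  have orbit_image: "g ` orbit x \<subseteq> orbit (g x)" if "g \<in> P" for g x
  proof
    fix y assume "y \<in> g ` orbit x"
    then obtain n where n: "n \<in> N" "y = g (n x)" by (auto simp: orbit_def)
    then have "g \<circ> n \<circ> pinv g \<in> N" "(g \<circ> n \<circ> pinv g) (g x) = y"
      using N that by (auto simp: normal_in_def)
    then show "y \<in> orbit (g x)" unfolding orbit_def by (metis image_eqI)
  qed
  have "g ` B \<in> Q" if gB: "g \<in> P" "B \<in> Q" for g B
  proof -
    obtain x where x: "x \<in> \<Omega>" "B = orbit x" using gB by (auto simp: Q_def)
    have "orbit (g x) \<subseteq> g ` orbit x"
    proof
      fix y assume "y \<in> orbit (g x)"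
      then have "pinv g y \<in> orbit (pinv g (g x))"
        using orbit_image[OF inv_closed[OF gB(1)], of "g x"] by auto
      then show "y \<in> g ` orbit x" using gB(1) by (auto intro!: image_eqI[of _ _ "pinv g y"])
    qed
    then have "g ` orbit x = orbit (g x)" using orbit_image[OF gB(1)] by blast
    then show ?thesis using x gB in_domain_iff by (auto simp: Q_def)
  qed
  with part prim have "Q = {\<Omega>} \<or> Q = (\<lambda>x. {x}) ` \<Omega>"
    unfolding primitive_on_def by blast
  then show ?thesis
  proof
    assume "Q = {\<Omega>}"
    then have "orbit x = \<Omega>" if "x \<in> \<Omega>" for x using that by (auto simp: Q_def)
    then show ?thesis unfolding transitive_on_def orbit_def by blast
  next
    assume Q: "Q = (\<lambda>x. {x}) ` \<Omega>"
    obtain x where x: "n\<^sub>0 x \<noteq> x" using nontriv by (auto simp: fun_eq_iff)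
    then have "x \<in> \<Omega>" using fixes_outside NP nontriv by blast
    then have "orbit x \<in> (\<lambda>x. {x}) ` \<Omega>" using Q by (auto simp: Q_def)
    then obtain y where "orbit x = {y}" by blast
    moreover have "n\<^sub>0 x \<in> orbit x" using nontriv by (auto simp: orbit_def)
    ultimately show ?thesis using self[of x] x by auto
  qed
qed

text \<open>The centre Z of A is invariant under conjugation by P and contains
  \<open>z\<^sub>0\<close>, hence is transitive. A permutation commuting with a transitive group is
  determined by one value, so every element of A coincides with an element of Z.\<close>

lemma primitive_normal_abelian:
  assumes prim: "primitive_on P \<Omega>" and A: "normal_in A"
    and z: "z\<^sub>0 \<in> A" "z\<^sub>0 \<noteq> id" "\<And>a. a \<in> A \<Longrightarrow> a \<circ> z\<^sub>0 = z\<^sub>0 \<circ> a"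
    and ab: "a \<in> A" "b \<in> A"
  shows "a \<circ> b = b \<circ> a"
proof -
  define Z where "Z = {z \<in> A. \<forall>a\<in>A. a \<circ> z = z \<circ> a}"
  have AP: "a \<in> P" if "a \<in> A" for a using A that by (auto simp: normal_in_def)
  have Zc: "z (a x) = a (z x)" if "z \<in> Z" "a \<in> A" for z a x
    using that unfolding Z_def by (metis (mono_tags, lifting) comp_apply mem_Collect_eq)
  have "normal_in Z"
    unfolding normal_in_def
  proof (intro conjI ballI)
    show "Z \<subseteq> P" using AP by (auto simp: Z_def)
    show "id \<in> Z" using A by (auto simp: Z_def normal_in_def)
    fix a assume a: "a \<in> Z"
    then have aA: "a \<in> A" by (auto simp: Z_def)
    {
      fix b assume b: "b \<in> Z"
      then have "a \<circ> b \<in> A" using A aA by (auto simp: normal_in_def Z_def)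
      moreover have "c (a (b x)) = a (b (c x))" if "c \<in> A" for c x
        using Zc[OF a that] Zc[OF b that] by metis
      ultimately show "a \<circ> b \<in> Z" by (auto simp: Z_def fun_eq_iff)
    }
    have "pinv a (b x) = b (pinv a x)" if "b \<in> A" for b x
      using Zc[OF a that, of "pinv a x"] AP[OF aA] by (metis inv_apply)
    moreover have "pinv a \<in> A" using A aA by (auto simp: normal_in_def)
    ultimately show "pinv a \<in> Z" by (auto simp: Z_def fun_eq_iff)
    fix g assume g: "g \<in> P"
    have "g \<circ> a \<circ> pinv g \<in> A" using A aA g by (auto simp: normal_in_def)
    moreover have "(g \<circ> a \<circ> pinv g) (b x) = b ((g \<circ> a \<circ> pinv g) x)" if "b \<in> A" for b x
    proof -
      \<comment> \<open>Since a is central in A, it commutes with this conjugate of b; conjugating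
        back by g gives the claim.\<close>
      have "pinv g \<circ> b \<circ> pinv (pinv g) \<in> A"
        using A that inv_closed[OF g] unfolding normal_in_def by blast
      from Zc[OF a this, of "pinv g x"] show ?thesis
        using g by (simp add: inv_inv)
    qed
    ultimately show "g \<circ> a \<circ> pinv g \<in> Z" by (auto simp: Z_def fun_eq_iff)
  qed
  moreover have "z\<^sub>0 \<in> Z" using z by (auto simp: Z_def)
  ultimately have trans: "transitive_on Z \<Omega>"
    using primitive_normal_transitive[OF prim] z(2) by blast
  have "a \<in> Z"
  proof (cases "\<Omega> = {}")
    case True
    then have "a = id" using fixes_outside AP ab by fastforce
    then show ?thesis using \<open>normal_in Z\<close> by (auto simp: normal_in_def)
  next
    case False
    then obtain x where x: "x \<in> \<Omega>" by blast
    then have "a x \<in> \<Omega>" using in_domain_iff AP ab by blast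
    then obtain z where z: "z \<in> Z" "z x = a x" using trans x unfolding transitive_on_def by blast
    then have zA: "z \<in> A" by (auto simp: Z_def)
    \<comment> \<open>Both a and z commute with every \<open>z'\<close> in Z, and such
      \<open>z'\<close> carry x to any point of the domain, so agreement at x spreads
      everywhere.\<close>
    have "a y = z y" for y
    proof (cases "y \<in> \<Omega>")
      case True
      then obtain z' where z': "z' \<in> Z" "z' x = y" using trans x unfolding transitive_on_def by blast
      then show ?thesis using Zc[OF z'(1), of a x] Zc[OF z'(1), of z x] z ab zA by metis
    next
      case False
      then show ?thesis using fixes_outside AP ab zA by metis
    qed
    then show ?thesis using z by (metis ext)
  qed
  then show ?thesis using ab by (auto simp: Z_def)
qed

end

section \<open>The Frobenius norm\<close>

text \<open>This norm is submultiplicative, invariant under orthogonal factors and computed from the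
  entries, which is what the rounding argument controls. Writing it with \<open>L2_set\<close> over
  index pairs supplies the triangle inequality.\<close>

definition frobenius_norm :: "real mat \<Rightarrow> real" where
  "frobenius_norm A = L2_set (\<lambda>(i, j). A $$ (i, j)) ({..<dim_row A} \<times> {..<dim_col A})"

lemma frobenius_norm_sq:
  "(frobenius_norm A)\<^sup>2 = (\<Sum>i<dim_row A. \<Sum>j<dim_col A. (A $$ (i, j))\<^sup>2)"
  unfolding frobenius_norm_def L2_set_def
  by (subst real_sqrt_pow2) (auto intro!: sum_nonneg simp: sum.cartesian_product case_prod_beta)

lemma frobenius_norm_nonneg: "0 \<le> frobenius_norm A"
  by (simp add: frobenius_norm_def)

lemma frobenius_norm_transpose: "frobenius_norm (transpose_mat A) = frobenius_norm A"
proof -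
  have "(frobenius_norm (transpose_mat A))\<^sup>2 = (frobenius_norm A)\<^sup>2"
    unfolding frobenius_norm_sq by (subst sum.swap) simp
  then show ?thesis by (simp add: frobenius_norm_nonneg)
qed

lemma frobenius_norm_diff_triangle:
  assumes "A \<in> carrier_mat n m" "B \<in> carrier_mat n m"
  shows "frobenius_norm (A - B) \<le> frobenius_norm A + frobenius_norm B"
proof -
  let ?S = "{..<n} \<times> {..<m}"
  have "frobenius_norm (A - B) = L2_set (\<lambda>p. A $$ p + - (B $$ p)) ?S"
    unfolding frobenius_norm_def using assms by (intro L2_set_cong) auto
  also have "\<dots> \<le> L2_set (($$) A) ?S + L2_set (\<lambda>p. - (B $$ p)) ?S"
    by (rule L2_set_triangle_ineq)
  also have "\<dots> = frobenius_norm A + frobenius_norm B"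
    unfolding frobenius_norm_def L2_set_def using assms by (simp add: case_prod_beta)
  finally show ?thesis .
qed

text \<open>Cauchy-Schwarz bounds each squared entry of the product by a squared row norm of A times
  a squared column norm of B, and the double sum factors.\<close>

lemma frobenius_norm_mult_le:
  assumes A: "A \<in> carrier_mat n m" and B: "B \<in> carrier_mat m l"
  shows "frobenius_norm (A * B) \<le> frobenius_norm A * frobenius_norm B"
proof (rule power2_le_imp_le)
  have "(frobenius_norm (A * B))\<^sup>2 = (\<Sum>i<n. \<Sum>j<l. (\<Sum>k<m. A $$ (i, k) * B $$ (k, j))\<^sup>2)"
    unfolding frobenius_norm_sq using A B
    by (auto simp: scalar_prod_def atLeast0LessThan intro!: sum.cong)
  also have "\<dots> \<le> (\<Sum>i<n. \<Sum>j<l. (\<Sum>k<m. (A $$ (i, k))\<^sup>2) * (\<Sum>k<m. (B $$ (k, j))\<^sup>2))"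
  proof (intro sum_mono)
    fix i j
    let ?f = "\<lambda>k. A $$ (i, k)" and ?g = "\<lambda>k. B $$ (k, j)"
    have "\<bar>\<Sum>k<m. ?f k * ?g k\<bar> \<le> (\<Sum>k<m. \<bar>?f k\<bar> * \<bar>?g k\<bar>)"
      by (rule order_trans[OF sum_abs]) (simp add: abs_mult)
    also have "\<dots> \<le> L2_set ?f {..<m} * L2_set ?g {..<m}" by (rule L2_set_mult_ineq)
    finally have "(\<Sum>k<m. ?f k * ?g k)\<^sup>2 \<le> (L2_set ?f {..<m} * L2_set ?g {..<m})\<^sup>2"
      by (simp add: abs_le_square_iff[symmetric] L2_set_nonneg abs_mult)
    also have "\<dots> = (\<Sum>k<m. (?f k)\<^sup>2) * (\<Sum>k<m. (?g k)\<^sup>2)"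
      unfolding L2_set_def power_mult_distrib by (simp add: sum_nonneg)
    finally show "(\<Sum>k<m. ?f k * ?g k)\<^sup>2 \<le> (\<Sum>k<m. (?f k)\<^sup>2) * (\<Sum>k<m. (?g k)\<^sup>2)" .
  qed
  also have "\<dots> = (\<Sum>i<n. \<Sum>k<m. (A $$ (i, k))\<^sup>2) * (\<Sum>j<l. \<Sum>k<m. (B $$ (k, j))\<^sup>2)"
    by (simp add: sum_product)
  also have "\<dots> = (frobenius_norm A * frobenius_norm B)\<^sup>2"
    unfolding power_mult_distrib frobenius_norm_sq using A B
    by (simp add: sum.swap[of _ "{..<l}" "{..<m}"])
  finally show "(frobenius_norm (A * B))\<^sup>2 \<le> (frobenius_norm A * frobenius_norm B)\<^sup>2" .
qed (simp add: frobenius_norm_nonneg)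

text \<open>The squared norm of B is the trace of its Gram matrix
  \<open>transpose_mat B * B\<close>, in which Q cancels.\<close>

lemma frobenius_norm_orthogonal_mult_left:
  assumes Q: "Q \<in> carrier_mat m m" "transpose_mat Q * Q = 1\<^sub>m m" and A: "A \<in> carrier_mat m n"
  shows "frobenius_norm (Q * A) = frobenius_norm A"
proof -
  have tr: "(frobenius_norm B)\<^sup>2 = (\<Sum>j<n. (transpose_mat B * B) $$ (j, j))"
    if "B \<in> carrier_mat m n" for B
    unfolding frobenius_norm_sq using that
    by (subst sum.swap) (auto simp: scalar_prod_def atLeast0LessThan power2_eq_square intro!: sum.cong)
  have "transpose_mat (Q * A) * (Q * A) = transpose_mat A * (transpose_mat Q * Q) * A"
    using Q(1) A by (simp add: transpose_mult[of _ m m] assoc_mult_mat[of _ n m _ m _ n]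
        assoc_mult_mat[of _ m m _ m _ n])
  also have "\<dots> = transpose_mat A * A" using Q A by simp
  finally have "(frobenius_norm (Q * A))\<^sup>2 = (frobenius_norm A)\<^sup>2"
    using tr[of "Q * A"] tr[of A] Q A by simp
  then show ?thesis by (simp add: frobenius_norm_nonneg)
qed

lemma frobenius_norm_orthogonal_mult_right:
  assumes Q: "Q \<in> carrier_mat m m" "Q * transpose_mat Q = 1\<^sub>m m" and A: "A \<in> carrier_mat n m"
  shows "frobenius_norm (A * Q) = frobenius_norm A"
proof -
  have "frobenius_norm (A * Q) = frobenius_norm (transpose_mat Q * transpose_mat A)"
    using transpose_mult[OF A Q(1)] frobenius_norm_transpose[of "A * Q"] by simp
  also have "\<dots> = frobenius_norm (transpose_mat A)"
    using Q A by (intro frobenius_norm_orthogonal_mult_left) auto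
  finally show ?thesis by (simp add: frobenius_norm_transpose)
qed

lemma frobenius_norm_eq_0:
  assumes "A \<in> carrier_mat n m" "frobenius_norm A = 0"
  shows "A = 0\<^sub>m n m"
proof (rule eq_matI)
  fix i j assume "i < dim_row (0\<^sub>m n m :: real mat)" "j < dim_col (0\<^sub>m n m :: real mat)"
  then have "(i, j) \<in> {..<dim_row A} \<times> {..<dim_col A}" using assms by auto
  then have "A $$ (i, j) = 0"
    using assms(2) unfolding frobenius_norm_def by (subst (asm) L2_set_eq_0_iff) auto
  with \<open>i < _\<close> \<open>j < _\<close> show "A $$ (i, j) = 0\<^sub>m n m $$ (i, j)" by simp
qed (use assms in auto)

text \<open>The identity matrix is central, so subtracting it leaves an additive commutator
  unchanged. For G and S near the identity the commutator is therefore a difference of products of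
  two small factors.\<close>

lemma commutator_minus_one_mat:
  assumes G: "G \<in> carrier_mat m m" and S: "(S :: real mat) \<in> carrier_mat m m"
  shows "(G - 1\<^sub>m m) * (S - 1\<^sub>m m) - (S - 1\<^sub>m m) * (G - 1\<^sub>m m) = G * S - S * G"
proof -
  have "(X - 1\<^sub>m m) * (Y - 1\<^sub>m m) = X * Y - X - (Y - 1\<^sub>m m)"
    if XY: "X \<in> carrier_mat m m" "Y \<in> carrier_mat m m" for X Y :: "real mat"
  proof -
    have "(X - 1\<^sub>m m) * (Y - 1\<^sub>m m) = X * (Y - 1\<^sub>m m) - 1\<^sub>m m * (Y - 1\<^sub>m m)"
      using XY by (intro minus_mult_distrib_mat) auto
    also have "X * (Y - 1\<^sub>m m) = X * Y - X * 1\<^sub>m m"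
      using XY by (intro mult_minus_distrib_mat) auto
    finally show ?thesis using XY by simp
  qed
  then show ?thesis using G S by (intro eq_matI) auto
qed

section \<open>Jordan's theorem for primitive groups\<close>

text \<open>Orthogonality enters through \<open>rep_inv\<close>: combined with multiplicativity it
  makes every \<open>\<rho> g\<close> an orthogonal matrix.\<close>

locale orthogonal_representation = permutation_group +
  fixes m :: nat and \<rho> :: "(nat \<Rightarrow> nat) \<Rightarrow> real mat"
  assumes carrier: "g \<in> P \<Longrightarrow> \<rho> g \<in> carrier_mat m m"
    and rep_id: "\<rho> id = 1\<^sub>m m"
    and rep_comp: "g \<in> P \<Longrightarrow> h \<in> P \<Longrightarrow> \<rho> (g \<circ> h) = \<rho> g * \<rho> h"
    and rep_inv: "g \<in> P \<Longrightarrow> \<rho> (pinv g) = transpose_mat (\<rho> g)"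
    and faithful: "g \<in> P \<Longrightarrow> \<rho> g = 1\<^sub>m m \<Longrightarrow> g = id"
begin

definition displacement :: "(nat \<Rightarrow> nat) \<Rightarrow> real" where
  "displacement g = frobenius_norm (\<rho> g - 1\<^sub>m m)"

lemma orthogonal:
  assumes "g \<in> P"
  shows "transpose_mat (\<rho> g) * \<rho> g = 1\<^sub>m m" "\<rho> g * transpose_mat (\<rho> g) = 1\<^sub>m m"
  using rep_comp[OF inv_closed[OF assms] assms] rep_comp[OF assms inv_closed[OF assms]] assms
  by (simp_all add: rep_inv comp_inv rep_id)

text \<open>The rows of an orthogonal matrix are unit vectors. This confines the entries to a
  bounded interval, so that rounding them gives finitely many codes.\<close>

lemma entry_bound:
  assumes g: "g \<in> P" and ij: "i < m" "j < m"
  shows "\<bar>\<rho> g $$ (i, j)\<bar> \<le> 1"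
proof -
  have "(\<rho> g $$ (i, j))\<^sup>2 \<le> (\<Sum>k<m. (\<rho> g $$ (i, k))\<^sup>2)"
    using ij by (intro member_le_sum) auto
  also have "\<dots> = (\<rho> g * transpose_mat (\<rho> g)) $$ (i, i)"
    using carrier[OF g] ij by (auto simp: scalar_prod_def power2_eq_square atLeast0LessThan)
  also have "\<dots> = 1" using orthogonal(2)[OF g] ij by simp
  finally show ?thesis by (simp add: abs_square_le_1)
qed

lemma displacement_pos:
  assumes g: "g \<in> P" and "g \<noteq> id"
  shows "displacement g > 0"
proof (rule ccontr)
  assume "\<not> displacement g > 0"
  then have "frobenius_norm (\<rho> g - 1\<^sub>m m) = 0"
    using frobenius_norm_nonneg[of "\<rho> g - 1\<^sub>m m"] unfolding displacement_def by linarith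
  then have 0: "\<rho> g - 1\<^sub>m m = 0\<^sub>m m m" by (intro frobenius_norm_eq_0) auto
  have "\<rho> g = 1\<^sub>m m"
  proof (rule eq_matI)
    fix i j assume ij: "i < dim_row (1\<^sub>m m :: real mat)" "j < dim_col (1\<^sub>m m :: real mat)"
    then have "(\<rho> g - 1\<^sub>m m) $$ (i, j) = 0" using 0 by simp
    then show "\<rho> g $$ (i, j) = 1\<^sub>m m $$ (i, j)" using ij carrier[OF g] by simp
  qed (use carrier[OF g] in auto)
  then show False using faithful assms by blast
qed

text \<open>Right multiplication by the transpose of \<open>\<rho> h\<close> is an isometry. Two
  elements with nearby matrices thus have a quotient of small displacement.\<close>

lemma displacement_comp_inv:
  assumes g: "g \<in> P" and h: "h \<in> P"
  shows "displacement (g \<circ> pinv h) = frobenius_norm (\<rho> g - \<rho> h)"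
proof -
  note c = carrier[OF g] carrier[OF h]
  have "\<rho> (g \<circ> pinv h) - 1\<^sub>m m = (\<rho> g - \<rho> h) * transpose_mat (\<rho> h)"
    using c g h inv_closed[OF h] orthogonal[OF h]
    by (simp add: rep_comp rep_inv minus_mult_distrib_mat[of _ m m])
  moreover have "frobenius_norm ((\<rho> g - \<rho> h) * transpose_mat (\<rho> h)) = frobenius_norm (\<rho> g - \<rho> h)"
    using c orthogonal[OF h] by (intro frobenius_norm_orthogonal_mult_right[of _ m _ m]) auto
  ultimately show ?thesis by (simp add: displacement_def)
qed

text \<open>Multiplication by \<open>\<rho> g\<close> on either side is an isometry. The set of
  elements of a given displacement is therefore closed under conjugation.\<close>

lemma displacement_conj:
  assumes g: "g \<in> P" and a: "a \<in> P"
  shows "displacement (g \<circ> a \<circ> pinv g) = displacement a"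
proof -
  note c = carrier[OF g] carrier[OF a]
  have "displacement (g \<circ> a \<circ> pinv g) = frobenius_norm (\<rho> (g \<circ> a) - \<rho> g)"
    using displacement_comp_inv comp_closed g a by simp
  also have "\<rho> (g \<circ> a) - \<rho> g = \<rho> g * (\<rho> a - 1\<^sub>m m)"
    using c g a by (simp add: rep_comp mult_minus_distrib_mat[of _ m m])
  also have "frobenius_norm \<dots> = displacement a"
    unfolding displacement_def using c orthogonal[OF g]
    by (intro frobenius_norm_orthogonal_mult_left[of _ m _ m]) auto
  finally show ?thesis .
qed

text \<open>The permutation on the left is the group commutator of g and s, whose displacement is
  the norm of the matrix commutator. The factor 2 is the source of the threshold 1/2 for small
  elements.\<close>

lemma displacement_commutator:
  assumes g: "g \<in> P" and s: "s \<in> P"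
  shows "displacement (g \<circ> s \<circ> pinv (s \<circ> g)) \<le> 2 * displacement g * displacement s"
proof -
  note c = carrier[OF g] carrier[OF s]
  let ?G = "\<rho> g - 1\<^sub>m m" and ?S = "\<rho> s - 1\<^sub>m m"
  have GS: "?G \<in> carrier_mat m m" "?S \<in> carrier_mat m m" by auto
  have "displacement (g \<circ> s \<circ> pinv (s \<circ> g)) = frobenius_norm (\<rho> (g \<circ> s) - \<rho> (s \<circ> g))"
    using displacement_comp_inv comp_closed g s by simp
  also have "\<rho> (g \<circ> s) - \<rho> (s \<circ> g) = ?G * ?S - ?S * ?G"
    using c g s by (simp add: rep_comp commutator_minus_one_mat)
  also have "frobenius_norm \<dots> \<le> frobenius_norm (?G * ?S) + frobenius_norm (?S * ?G)"
    using GS by (intro frobenius_norm_diff_triangle[of _ m m]) auto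
  also have "\<dots> \<le> displacement g * displacement s + displacement s * displacement g"
    unfolding displacement_def using GS by (intro add_mono frobenius_norm_mult_le[of _ m m _ m])
  finally show ?thesis by (metis mult.assoc mult.commute mult_2)
qed

text \<open>A nontrivial element of least displacement commutes with every element of displacement
  below 1/2, since their commutator is displaced even less. So the centralizer A of the set
  of all such minimal elements contains the elements of small displacement and has nontrivial centre,
  and primitivity forces A to equal its centre.\<close>
lemma small_elements_abelian:
  assumes prim: "primitive_on P \<Omega>"
  obtains A where "normal_in A" "\<And>a b. a \<in> A \<Longrightarrow> b \<in> A \<Longrightarrow> a \<circ> b = b \<circ> a"
    "\<And>s. s \<in> P \<Longrightarrow> displacement s < 1 / 2 \<Longrightarrow> s \<in> A"
proof (cases "\<exists>s\<in>P. s \<noteq> id \<and> displacement s < 1 / 2")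
  case False
  \<comment> \<open>Here the identity is the only element of displacement below 1/2, so the trivial
    subgroup suffices.\<close>
  have "pinv (id :: nat \<Rightarrow> nat) = id" by (simp add: inv_id)
  then have "normal_in {id}" using id_closed comp_inv by (auto simp: normal_in_def)
  then show ?thesis using False that[of "{id}"] by auto
next
  case True
  then obtain s\<^sub>0 where s\<^sub>0: "s\<^sub>0 \<in> P" "s\<^sub>0 \<noteq> id" "displacement s\<^sub>0 < 1 / 2" by blast
  define d where "d = Min (displacement ` (P - {id}))"
  have fin: "finite (displacement ` (P - {id}))" using finite_group by auto
  have d_le: "d \<le> displacement g" if "g \<in> P" "g \<noteq> id" for g
    unfolding d_def using that fin by (intro Min_le) auto
  have "d \<in> displacement ` (P - {id})"
    unfolding d_def using fin s\<^sub>0 by (intro Min_in) auto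
  then obtain z\<^sub>0 where z\<^sub>0: "z\<^sub>0 \<in> P" "z\<^sub>0 \<noteq> id" "displacement z\<^sub>0 = d" by auto
  define M where "M = {g \<in> P. g \<noteq> id \<and> displacement g = d}"
  define A where "A = {a \<in> P. \<forall>z\<in>M. \<forall>x. a (z x) = z (a x)}"
  have small: "s \<in> A" if s: "s \<in> P" "displacement s < 1 / 2" for s
  proof -
    have "s (z x) = z (s x)" if z: "z \<in> M" for z x
    proof -
      from z have zP: "z \<in> P" "z \<noteq> id" "displacement z = d" by (auto simp: M_def)
      let ?c = "z \<circ> s \<circ> pinv (s \<circ> z)"
      have c: "?c \<in> P" using zP s comp_closed inv_closed by simp
      have "displacement ?c \<le> d * (2 * displacement s)"
        using displacement_commutator[OF zP(1) s(1)] zP by (simp add: mult_ac)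
      also have "\<dots> < d * 1"
        using s displacement_pos[OF zP(1,2)] zP by (intro mult_strict_left_mono) auto
      finally have "?c = id" using d_le[OF c] by force
      then have "z (s (pinv (s \<circ> z) ((s \<circ> z) x))) = (s \<circ> z) x"
        by (metis comp_apply id_apply)
      then show ?thesis using inv_apply(1)[OF comp_closed[OF s(1) zP(1)], of x] by simp
    qed
    then show ?thesis using s by (auto simp: A_def)
  qed
  \<comment> \<open>Closure of \<open>M\<close> under conjugation is what makes its centralizer
    \<open>A\<close> normal.\<close>
  have M_conj: "pinv g \<circ> z \<circ> g \<in> M" if "z \<in> M" "g \<in> P" for z g
  proof -
    from that have z: "z \<in> P" "z \<noteq> id" "displacement z = d" by (auto simp: M_def)
    have "displacement (pinv g \<circ> z \<circ> g) = d"
      using displacement_conj[OF inv_closed[OF that(2)] z(1)] z that by (simp add: inv_inv)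
    moreover have "pinv g \<circ> z \<circ> g \<in> P" using z that comp_closed inv_closed by simp
    moreover have "pinv g \<circ> z \<circ> g \<noteq> id"
    proof
      assume eq: "pinv g \<circ> z \<circ> g = id"
      have "z x = x" for x
        using fun_cong[OF eq, of "pinv g x"] that(2) by simp (metis inv_apply(2))
      then show False using z by auto
    qed
    ultimately show ?thesis by (simp add: M_def)
  qed
  have AP: "a \<in> P" if "a \<in> A" for a using that by (auto simp: A_def)
  have AM: "a (z x) = z (a x)" if "a \<in> A" "z \<in> M" for a z x using that by (auto simp: A_def)
  have "normal_in A"
    unfolding normal_in_def
  proof (intro conjI ballI)
    show "A \<subseteq> P" using AP by blast
    show "id \<in> A" using id_closed by (auto simp: A_def)
    fix a assume a: "a \<in> A"
    {
      fix b assume b: "b \<in> A"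
      have "a (b (z x)) = z (a (b x))" if "z \<in> M" for z x
        using AM[OF a that] AM[OF b that] by metis
      then show "a \<circ> b \<in> A" using comp_closed[OF AP[OF a] AP[OF b]]
        unfolding A_def mem_Collect_eq o_apply by blast
    }
    have "pinv a (z x) = z (pinv a x)" if "z \<in> M" for z x
      using AM[OF a that, of "pinv a x"] AP[OF a] by (metis inv_apply)
    then show "pinv a \<in> A" using inv_closed[OF AP[OF a]]
      unfolding A_def mem_Collect_eq by blast
    fix g assume g: "g \<in> P"
    have "g (a (pinv g (z x))) = z (g (a (pinv g x)))" if "z \<in> M" for z x
      using arg_cong[OF AM[OF a M_conj[OF that g], of "pinv g x"], of g] g by simp
    then show "g \<circ> a \<circ> pinv g \<in> A"
      using comp_closed[OF comp_closed[OF g AP[OF a]] inv_closed[OF g]]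
      unfolding A_def mem_Collect_eq o_apply by blast
  qed
  moreover have "z\<^sub>0 \<in> M" using z\<^sub>0 by (auto simp: M_def)
  \<comment> \<open>By minimality d is at most the displacement of \<open>s\<^sub>0\<close>, so
    \<open>z\<^sub>0\<close> is itself small and lies in \<open>A\<close>. Being also in
    \<open>M\<close>, it is central there.\<close>
  moreover have "z\<^sub>0 \<in> A" using small z\<^sub>0 d_le[of s\<^sub>0] s\<^sub>0 by simp
  moreover from \<open>z\<^sub>0 \<in> M\<close> have "a \<circ> z\<^sub>0 = z\<^sub>0 \<circ> a" if "a \<in> A" for a
    using that AM by fastforce
  ultimately have "a \<circ> b = b \<circ> a" if "a \<in> A" "b \<in> A" for a b
    using primitive_normal_abelian[of A z\<^sub>0 a b] prim z\<^sub>0(2) that by blast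
  with \<open>normal_in A\<close> small show ?thesis using that by blast
qed

text \<open>A pigeonhole argument: round the matrix entries to a grid of mesh 1/K. Elements with
  equal codes differ by an element of displacement below 1/2, hence lie in the same right coset of
  the abelian subgroup, so the index is at most the number of codes.\<close>

theorem abelian_normal_small_index:
  assumes prim: "primitive_on P \<Omega>"
  obtains A where "normal_in A" "\<And>a b. a \<in> A \<Longrightarrow> b \<in> A \<Longrightarrow> a \<circ> b = b \<circ> a"
    "card P \<le> (4 * m + 3) ^ (m * m) * card A"
proof -
  obtain A where A: "normal_in A" "\<And>a b. a \<in> A \<Longrightarrow> b \<in> A \<Longrightarrow> a \<circ> b = b \<circ> a"
    "\<And>s. s \<in> P \<Longrightarrow> displacement s < 1 / 2 \<Longrightarrow> s \<in> A"
    using small_elements_abelian[OF prim] by blast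
  let ?I = "{..<m} \<times> {..<m}"
  \<comment> \<open>With m squared entries each off by at most 1/K, the Frobenius distance is at
    most m/K, which this choice keeps below 1/2. The range from -K to K has 2K + 1 = 4m + 3
    integers.\<close>
  define K where "K = 2 * m + 1"
  define code where
    "code g = restrict (\<lambda>p. \<lfloor>real K * (\<rho> g $$ p)\<rfloor>) ?I" for g
  define C where "C = (?I \<rightarrow>\<^sub>E {- int K..int K})"
  have finC: "finite C" unfolding C_def by (intro finite_PiE) auto
  have "card C = (4 * m + 3) ^ (m * m)"
    by (simp add: C_def K_def card_PiE nat_add_distrib nat_mult_distrib add.commute)
  have code_in: "code g \<in> C" if g: "g \<in> P" for g
    unfolding C_def code_def
  proof (rule restrict_PiE_iff[THEN iffD2], rule ballI)
    fix p assume "p \<in> ?I"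
    then have "\<bar>\<rho> g $$ p\<bar> \<le> 1" using entry_bound[OF g] by auto
    then have "\<bar>real K * (\<rho> g $$ p)\<bar> \<le> real K"
      by (simp add: abs_mult mult_left_le)
    then show "\<lfloor>real K * (\<rho> g $$ p)\<rfloor> \<in> {- int K..int K}"
      by (auto simp: le_floor_iff floor_le_iff abs_le_iff)
  qed
  have same_coset: "g \<circ> pinv h \<in> A" if gh: "g \<in> P" "h \<in> P" "code g = code h" for g h
  proof -
    note c = carrier[OF gh(1)] carrier[OF gh(2)]
    have entry: "\<bar>\<rho> g $$ p - \<rho> h $$ p\<bar> \<le> 1 / real K" if "p \<in> ?I" for p
    proof -
      have "\<lfloor>real K * (\<rho> g $$ p)\<rfloor> = \<lfloor>real K * (\<rho> h $$ p)\<rfloor>"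
        using fun_cong[OF gh(3), of p] that by (simp add: code_def)
      then have "\<bar>real K * (\<rho> g $$ p) - real K * (\<rho> h $$ p)\<bar> \<le> 1" by linarith
      then have "real K * \<bar>\<rho> g $$ p - \<rho> h $$ p\<bar> \<le> 1"
        by (simp add: right_diff_distrib[symmetric] abs_mult)
      then show ?thesis by (simp add: K_def field_simps)
    qed
    have "(frobenius_norm (\<rho> g - \<rho> h))\<^sup>2 = (\<Sum>i<m. \<Sum>j<m. (\<rho> g $$ (i, j) - \<rho> h $$ (i, j))\<^sup>2)"
      unfolding frobenius_norm_sq using c by auto
    also have "\<dots> \<le> (\<Sum>i<m. \<Sum>j<m. (1 / real K)\<^sup>2)"
      using entry by (intro sum_mono) (auto simp: abs_le_square_iff[symmetric])
    also have "\<dots> = (real m / real K)\<^sup>2" by (simp add: power2_eq_square)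
    finally have "frobenius_norm (\<rho> g - \<rho> h) \<le> real m / real K"
      by (rule power2_le_imp_le) simp
    also have "\<dots> < 1 / 2" by (simp add: K_def field_simps)
    finally show ?thesis
      using A(3) displacement_comp_inv gh comp_closed inv_closed by simp
  qed
  have "card P = (\<Sum>c\<in>C. card {g \<in> P. code g = c})"
  proof -
    have "P = (\<Union>c\<in>C. {g \<in> P. code g = c})" using code_in by auto
    then have "card P = card (\<Union>c\<in>C. {g \<in> P. code g = c})" by simp
    also have "\<dots> = (\<Sum>c\<in>C. card {g \<in> P. code g = c})"
      using finC finite_group by (intro card_UN_disjoint) auto
    finally show ?thesis .
  qed
  \<comment> \<open>Right composition with the inverse of one fixed member h maps a nonempty fibre
    of \<open>code\<close> injectively into A.\<close>
  also have "\<dots> \<le> (\<Sum>c\<in>C. card A)"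
  proof (rule sum_mono)
    fix c
    have finA: "finite A" using A(1) finite_group finite_subset by (auto simp: normal_in_def)
    show "card {g \<in> P. code g = c} \<le> card A"
    proof (cases "{g \<in> P. code g = c} = {}")
      case False
      then obtain h where h: "h \<in> P" "code h = c" by blast
      have "inj_on (\<lambda>g. g \<circ> pinv h) {g \<in> P. code g = c}"
      proof (rule inj_onI)
        fix g g' assume "g \<circ> pinv h = g' \<circ> pinv h"
        then have "(g \<circ> pinv h) (h x) = (g' \<circ> pinv h) (h x)" for x by simp
        then show "g = g'" using h by (auto simp: fun_eq_iff)
      qed
      moreover have "(\<lambda>g. g \<circ> pinv h) ` {g \<in> P. code g = c} \<subseteq> A"
        using same_coset h by auto
      ultimately show ?thesis using finA card_inj_on_le by blast
    next
      case True
      show ?thesis unfolding True by simp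
    qed
  qed
  also have "\<dots> = (4 * m + 3) ^ (m * m) * card A"
    using \<open>card C = _\<close> by simp
  finally show ?thesis using A that by blast
qed

end

section \<open>Eigenvalues of regular graphs\<close>

text \<open>The all-ones vector is an eigenvector for k. Taking it as first basis vector makes the
  matrix block triangular, and the similarity splits off exactly one factor for k, so multiplicities
  are preserved.\<close>

lemma char_poly_constant_row_sums:
  fixes A :: "'a :: field mat"
  assumes A: "A \<in> carrier_mat (Suc n) (Suc n)"
    and rows: "\<And>i. i \<le> n \<Longrightarrow> (\<Sum>j\<le>n. A $$ (i, j)) = k"
  shows "char_poly A =
    [:- k, 1:] * char_poly (mat n n (\<lambda>(i, j). A $$ (Suc i, Suc j) - A $$ (0, Suc j)))"
proof -
  define C where "C = mat n n (\<lambda>(i, j). A $$ (Suc i, Suc j) - A $$ (0, Suc j))"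
  define R where "R = mat 1 n (\<lambda>(i, j). A $$ (0, Suc j))"
  define L where "L = mat 1 1 (\<lambda>_. k)"
  define T where "T = four_block_mat L R (0\<^sub>m n 1) C"
  \<comment> \<open>Column 0 of \<open>Q\<close> is the all-ones vector and the other columns are
    unit vectors; \<open>Q'\<close> is its inverse.\<close>
  define Q :: "'a mat" where
    "Q = mat (Suc n) (Suc n) (\<lambda>(i, j). of_bool (i = j) + of_bool (j = 0 \<and> i \<noteq> 0))"
  define Q' :: "'a mat" where
    "Q' = mat (Suc n) (Suc n) (\<lambda>(i, j). of_bool (i = j) - of_bool (j = 0 \<and> i \<noteq> 0))"
  have blocks: "L \<in> carrier_mat 1 1" "R \<in> carrier_mat 1 n" "C \<in> carrier_mat n n"
    by (auto simp: L_def R_def C_def)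
  have T: "T \<in> carrier_mat (Suc n) (Suc n)" using blocks by (auto simp: T_def)
  have Q: "Q \<in> carrier_mat (Suc n) (Suc n)" "Q' \<in> carrier_mat (Suc n) (Suc n)"
    by (auto simp: Q_def Q'_def)
  have T_entry: "T $$ (i, j) = (if j = 0 then (if i = 0 then k else 0)
      else if i = 0 then A $$ (0, j) else A $$ (i, j) - A $$ (0, j))" if "i \<le> n" "j \<le> n" for i j
    using that by (auto simp: T_def L_def R_def C_def)
  have delta: "(\<Sum>l = 0..<Suc n. f l * of_bool (l = i)) = f i"
    "(\<Sum>l = 0..<Suc n. of_bool (i = l) * f l) = f i" if "i \<le> n" for f :: "nat \<Rightarrow> 'a" and i
    using that by (simp_all add: of_bool_def if_distrib[of "\<lambda>c. _ * c"]
        if_distrib[of "\<lambda>c. c * _"] sum.delta sum.delta' del: sum.op_ivl_Suc cong: if_cong)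
  \<comment> \<open>Left multiplication by \<open>Q\<close> adds row 0 to every other row, and by
    \<open>Q'\<close> subtracts it.\<close>
  have QX: "(Q * X) $$ (i, j) = X $$ (i, j) + of_bool (i \<noteq> 0) * X $$ (0, j)"
    "(Q' * X) $$ (i, j) = X $$ (i, j) - of_bool (i \<noteq> 0) * X $$ (0, j)"
    if "X \<in> carrier_mat (Suc n) (Suc n)" "i \<le> n" "j \<le> n" for X i j
  proof -
    have "(\<Sum>l = 0..<Suc n. (of_bool (i = l) + s * of_bool (0 = l)) * X $$ (l, j)) =
        X $$ (i, j) + s * X $$ (0, j)" for s
      unfolding distrib_right sum.distrib mult.assoc sum_distrib_left[symmetric]
      using that by (simp only: delta)
    note * = this[of "of_bool (i \<noteq> 0)"] this[of "- of_bool (i \<noteq> 0)"]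
    have "(Q * X) $$ (i, j) =
        (\<Sum>l = 0..<Suc n. (of_bool (i = l) + of_bool (i \<noteq> 0) * of_bool (0 = l)) * X $$ (l, j))"
      using that by (auto simp: Q_def scalar_prod_def simp del: sum.op_ivl_Suc intro!: sum.cong)
    then show "(Q * X) $$ (i, j) = X $$ (i, j) + of_bool (i \<noteq> 0) * X $$ (0, j)"
      by (simp only: *)
    have "(Q' * X) $$ (i, j) =
        (\<Sum>l = 0..<Suc n. (of_bool (i = l) + - of_bool (i \<noteq> 0) * of_bool (0 = l)) * X $$ (l, j))"
      using that by (auto simp: Q'_def scalar_prod_def simp del: sum.op_ivl_Suc intro!: sum.cong)
    then show "(Q' * X) $$ (i, j) = X $$ (i, j) - of_bool (i \<noteq> 0) * X $$ (0, j)"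
      by (simp only: *) simp
  qed
  have Q_entry: "Q $$ (i, j) = of_bool (i = j) + of_bool (j = 0 \<and> i \<noteq> 0)"
    and Q'_entry: "Q' $$ (i, j) = of_bool (i = j) - of_bool (j = 0 \<and> i \<noteq> 0)"
    if "i \<le> n" "j \<le> n" for i j
    using that by (auto simp: Q_def Q'_def)
  have "Q * Q' = 1\<^sub>m (Suc n)"
    using Q by (intro eq_matI) (auto simp: QX less_Suc_eq_le Q'_entry simp del: index_mult_mat(1))
  moreover have "Q' * Q = 1\<^sub>m (Suc n)"
    using Q by (intro eq_matI) (auto simp: QX less_Suc_eq_le Q_entry simp del: index_mult_mat(1))
  moreover have "Q' * A * Q = T"
  proof (rule eq_matI)
    fix i j assume "i < dim_row T" "j < dim_col T"
    then have ij: "i \<le> n" "j \<le> n" using T by auto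
    \<comment> \<open>Right multiplication by \<open>Q\<close> changes only column 0, which becomes
      the column of row sums.\<close>
    have AQ: "(A * Q) $$ (i, j) = (if j = 0 then k else A $$ (i, j))" if "i \<le> n" for i
    proof -
      have "(A * Q) $$ (i, j) = (\<Sum>l = 0..<Suc n. A $$ (i, l) * (of_bool (l = j) + of_bool (j = 0 \<and> l \<noteq> 0)))"
        using A ij that
        by (auto simp: Q_def scalar_prod_def simp del: sum.op_ivl_Suc intro!: sum.cong)
      also have "\<dots> = (if j = 0 then k else A $$ (i, j))"
      proof (cases "j = 0")
        case True
        have "of_bool (l = j) + of_bool (j = 0 \<and> l \<noteq> 0) = (1 :: 'a)" for l using True by auto
        then show ?thesis using rows[OF that] True
          by (simp add: atLeast0LessThan lessThan_Suc_atMost del: sum.op_ivl_Suc sum.lessThan_Suc)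
      next
        case False
        then show ?thesis using delta(1)[OF ij(2), of "\<lambda>l. A $$ (i, l)"] by (simp del: sum.op_ivl_Suc)
      qed
      finally show ?thesis .
    qed
    have "(Q' * (A * Q)) $$ (i, j) = T $$ (i, j)"
      using A Q ij by (auto simp: QX AQ T_entry simp del: index_mult_mat(1))
    then show "(Q' * A * Q) $$ (i, j) = T $$ (i, j)"
      using A Q by (simp add: assoc_mult_mat[of _ "Suc n" "Suc n" _ "Suc n" _ "Suc n"])
  qed (use Q T in auto)
  ultimately have "similar_mat T A"
    using A Q T by (intro similar_matI[of _ _ Q' Q "Suc n"]) auto
  then have "char_poly A = char_poly T" using char_poly_similar by metis
  also have "\<dots> = char_poly L * char_poly C"
    unfolding T_def by (rule char_poly_four_block_zeros_col[OF blocks])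
  also have "char_poly L = [:- k, 1:]"
    by (subst char_poly_upper_triangular[of _ 1]) (auto simp: L_def diag_mat_def)
  finally show ?thesis by (simp add: C_def)
qed

definition eigenfunction :: "nat \<Rightarrow> (nat \<Rightarrow> nat \<Rightarrow> bool) \<Rightarrow> real \<Rightarrow> (nat \<Rightarrow> real) \<Rightarrow> bool" where
  "eigenfunction v E \<mu> w \<longleftrightarrow> (\<forall>x<v. (\<Sum>y<v. of_bool (E x y) * w y) = \<mu> * w x)"

lemma regular_row_sum:
  assumes "regular_graph v E k" "x < v"
  shows "(\<Sum>y<v. of_bool (E x y)) = real k"
proof -
  have "{..<v} \<inter> {y. E x y} = {y. y < v \<and> E x y}" by auto
  then show ?thesis using assms by (simp add: sum_of_bool_eq regular_graph_def)
qed

text \<open>At a coordinate where an eigenvector has largest modulus, the eigenvalue equation bounds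
  the modulus of \<mu> by the row sum k. This identifies k as the maximum that \<open>Lambda\<close>
  discards.\<close>

lemma adj_eigenvalue_le:
  assumes reg: "regular_graph v E k" and root: "poly (char_poly (adj_matrix v E)) \<mu> = 0"
  shows "\<mu> \<le> k"
proof -
  have A: "adj_matrix v E \<in> carrier_mat v v" by (simp add: adj_matrix_def)
  then obtain u where "eigenvector (adj_matrix v E) u \<mu>"
    using eigenvalue_root_char_poly[OF A] root by (auto simp: eigenvalue_def)
  then have u: "u \<in> carrier_vec v" "u \<noteq> 0\<^sub>v v" "adj_matrix v E *\<^sub>v u = \<mu> \<cdot>\<^sub>v u"
    using A by (auto simp: eigenvector_def)
  obtain x\<^sub>0 where x\<^sub>0: "x\<^sub>0 < v" "u $ x\<^sub>0 \<noteq> 0"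
    using u(1,2) by (metis carrier_vecD eq_vecI index_zero_vec)
  let ?S = "(\<lambda>x. \<bar>u $ x\<bar>) ` {..<v}"
  have "Max ?S \<in> ?S" using x\<^sub>0 by (intro Max_in) auto
  then obtain x where x: "x < v" "Max ?S = \<bar>u $ x\<bar>" by auto
  have le: "\<bar>u $ y\<bar> \<le> \<bar>u $ x\<bar>" if "y < v" for y
    unfolding x(2)[symmetric] using that by (intro Max_ge) auto
  have "\<mu> * u $ x = (adj_matrix v E *\<^sub>v u) $ x" using u x by simp
  also have "\<dots> = (\<Sum>y<v. of_bool (E x y) * u $ y)"
    using u(1) x(1) by (auto simp: adj_matrix_def scalar_prod_def atLeast0LessThan simp del: sum_of_bool_mult_eq intro!: sum.cong)
  finally have "\<bar>\<mu>\<bar> * \<bar>u $ x\<bar> = \<bar>\<Sum>y<v. of_bool (E x y) * u $ y\<bar>" by (metis abs_mult)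
  also have "\<dots> \<le> (\<Sum>y<v. of_bool (E x y) * \<bar>u $ x\<bar>)"
    using le by (intro order_trans[OF sum_abs] sum_mono) (auto simp: abs_mult)
  also have "\<dots> = k * \<bar>u $ x\<bar>"
    using regular_row_sum[OF reg x(1)] by (simp add: sum_distrib_right[symmetric])
  finally have "\<bar>\<mu>\<bar> \<le> k" using le[OF x\<^sub>0(1)] x\<^sub>0(2) by (simp add: mult_le_cancel_right)
  then show ?thesis by simp
qed

text \<open>Splitting off the constant eigenfunction keeps track of multiplicities: the remaining
  eigenvalues are those of the deflated matrix C. An eigenvector of C, extended by 0,
  becomes an eigenfunction of the graph after its mean is subtracted.\<close>
lemma Lambda_eigenfunction:
  assumes graph: "simple_graph v E" and reg: "regular_graph v E k" and nz: "Lambda v E \<noteq> 0"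
  obtains \<mu> w where "\<bar>\<mu>\<bar> = \<bar>Lambda v E\<bar>" "eigenfunction v E \<mu> w" "\<exists>x<v. \<exists>y<v. w x \<noteq> w y"
proof -
  let ?A = "adj_matrix v E"
  have A: "?A \<in> carrier_mat v v" by (simp add: adj_matrix_def)
  have "v \<noteq> 0"
  proof
    assume "v = 0"
    \<comment> \<open>The empty graph has no eigenvalues, so \<open>Lambda\<close> takes its default
      value 0, contrary to \<open>nz\<close>.\<close>
    then have "char_poly ?A = 1"
      using A by (simp add: char_poly_def det_dim_zero[of "char_poly_matrix ?A"])
    then show False using nz by (simp add: Lambda_def adj_eigenvalues_def)
  qed
  then obtain n where v: "v = Suc n" by (cases v) auto
  have entry: "?A $$ (i, j) = of_bool (E i j)" if "i \<le> n" "j \<le> n" for i j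
    using that by (auto simp: adj_matrix_def v)
  define C where "C = mat n n (\<lambda>(i, j). ?A $$ (Suc i, Suc j) - ?A $$ (0, Suc j))"
  have C: "C \<in> carrier_mat n n" by (simp add: C_def)
  have "(\<Sum>j\<le>n. ?A $$ (i, j)) = real k" if "i \<le> n" for i
    using regular_row_sum[OF reg, of i] that entry[OF that]
    by (simp add: v lessThan_Suc_atMost less_Suc_eq_le)
  then have cp: "char_poly ?A = [:- real k, 1:] * char_poly C"
    unfolding C_def using char_poly_constant_row_sums[of ?A n "real k"] A v by simp
  have nzA: "char_poly ?A \<noteq> 0" and nzC: "char_poly C \<noteq> 0"
    using degree_monic_char_poly[OF A] degree_monic_char_poly[OF C] by auto
  define M' where "M' = proots (char_poly C)"
  have M: "adj_eigenvalues v E = add_mset (real k) M'"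
    unfolding adj_eigenvalues_def cp M'_def using nzC
    by (subst proots_mult) auto
  have "x \<le> real k" if "x \<in># adj_eigenvalues v E" for x
    using adj_eigenvalue_le[OF reg, of x] that nzA by (simp add: adj_eigenvalues_def)
  \<comment> \<open>Hence \<open>Lambda\<close> removes exactly one copy of k, and what remains is
    \<open>M'\<close>, the eigenvalues of \<open>C\<close>. The value k may still occur in
    \<open>M'\<close>.\<close>
  then have "Max (set_mset (adj_eigenvalues v E)) = real k"
    using M by (intro Max_eqI) auto
  then have Lam: "Lambda v E = (if M' = {#} then 0 else Max (abs ` set_mset M'))"
    by (simp add: Lambda_def M)
  then have ne: "M' \<noteq> {#}" using nz by auto
  then have "Lambda v E \<in> abs ` set_mset M'" using Lam by (auto intro!: Max_in)
  then obtain \<mu> where \<mu>: "\<mu> \<in># M'" "Lambda v E = \<bar>\<mu>\<bar>" by auto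
  then have "eigenvalue C \<mu>" using nzC by (simp add: eigenvalue_root_char_poly[OF C] M'_def)
  then obtain u where "eigenvector C u \<mu>" by (auto simp: eigenvalue_def)
  then have u: "u \<in> carrier_vec n" "u \<noteq> 0\<^sub>v n" "C *\<^sub>v u = \<mu> \<cdot>\<^sub>v u"
    using C by (auto simp: eigenvector_def)
  define y where "y x = (case x of 0 \<Rightarrow> 0 | Suc x' \<Rightarrow> u $ x')" for x
  define N where "N x = (\<Sum>z<v. of_bool (E x z) * y z)" for x
  have N: "N x = (\<Sum>z<n. of_bool (E x (Suc z)) * u $ z)" for x
    by (simp add: N_def v y_def sum.lessThan_Suc_shift del: sum.lessThan_Suc)
  \<comment> \<open>Rows of \<open>C\<close> are rows of the adjacency matrix minus row 0, so y
    satisfies the eigenvalue equation up to the additive constant \<open>N 0\<close>.\<close>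
  have Ny: "N x = \<mu> * y x + N 0" if "x < v" for x
  proof (cases x)
    case (Suc x')
    then have x': "x' < n" using that v by simp
    have "\<mu> * u $ x' = (C *\<^sub>v u) $ x'" using u x' by simp
    also have "\<dots> = (\<Sum>z<n. (of_bool (E x (Suc z)) - of_bool (E 0 (Suc z))) * u $ z)"
      using u(1) x' Suc by (auto simp: C_def entry scalar_prod_def atLeast0LessThan intro!: sum.cong)
    also have "\<dots> = N x - N 0" by (simp add: N left_diff_distrib sum_subtractf)
    finally show ?thesis by (simp add: y_def Suc)
  qed (simp add: y_def)
  define s where "s = (\<Sum>x<v. y x)"
  \<comment> \<open>Summing over all vertices in two ways determines that constant; symmetry turns
    the column sums into degrees.\<close>
  have "(\<Sum>x<v. N x) = (\<Sum>z<v. \<Sum>x<v. of_bool (E x z) * y z)"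
    unfolding N_def by (rule sum.swap)
  also have "\<dots> = (\<Sum>z<v. real k * y z)"
  proof (rule sum.cong[OF refl])
    fix z assume z: "z \<in> {..<v}"
    have "(\<Sum>x<v. of_bool (E x z) * y z) = (\<Sum>x<v. of_bool (E z x)) * y z"
      unfolding sum_distrib_right using graph z
      by (intro sum.cong) (auto simp: simple_graph_def)
    then show "(\<Sum>x<v. of_bool (E x z) * y z) = real k * y z"
      using regular_row_sum[OF reg] z by simp
  qed
  finally have "(\<Sum>x<v. N x) = real k * s" by (simp only: s_def sum_distrib_left)
  moreover have "(\<Sum>x<v. N x) = (\<Sum>x<v. \<mu> * y x + N 0)"
    by (rule sum.cong[OF refl], rule Ny) simp
  ultimately have mean: "\<mu> * s + real v * N 0 = real k * s"
    by (simp add: s_def sum.distrib sum_distrib_left)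
  define w where "w x = y x - s / real v" for x
  have "eigenfunction v E \<mu> w"
    unfolding eigenfunction_def
  proof (intro allI impI)
    fix x assume x: "x < v"
    have "(\<Sum>z<v. of_bool (E x z) * w z) = N x - real k * (s / real v)"
      unfolding N_def regular_row_sum[OF reg x, symmetric] w_def
      by (simp only: right_diff_distrib sum_subtractf sum_distrib_right)
    also have "\<dots> = \<mu> * w x"
    proof -
      have "real v \<noteq> 0" using x by simp
      then have "N 0 = (real k - \<mu>) * (s / real v)" using mean by (simp add: field_simps)
      then show ?thesis by (simp add: Ny[OF x] w_def left_diff_distrib right_diff_distrib
          diff_divide_distrib)
    qed
    finally show "(\<Sum>z<v. of_bool (E x z) * w z) = \<mu> * w x" .
  qed
  \<comment> \<open>Shifting by the mean preserves differences, and y vanishes at vertex 0 but not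
    at \<open>Suc x'\<close>, so w is not constant.\<close>
  moreover obtain x' where "x' < n" "u $ x' \<noteq> 0"
    using u(1,2) by (metis carrier_vecD eq_vecI index_zero_vec)
  then have "Suc x' < v" "w (Suc x') \<noteq> w 0" "0 < v" by (auto simp: w_def y_def v)
  ultimately show ?thesis using that \<mu>(2) by (metis abs_abs)
qed

text \<open>The combination has the shape of a normalised Gram-Schmidt residual, the form in which
  it extends an orthonormal system of eigenfunctions.\<close>

lemma eigenfunction_linear_combination:
  assumes "\<And>i. i < m \<Longrightarrow> eigenfunction v E \<mu> (u i)" and "eigenfunction v E \<mu> w"
  shows "eigenfunction v E \<mu> (\<lambda>x. s * (w x - (\<Sum>i<m. c i * u i x)))"
  unfolding eigenfunction_def
proof (intro allI impI)
  fix x assume x: "x < v"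
  have "(\<Sum>y<v. of_bool (E x y) * (\<Sum>i<m. c i * u i y)) =
      (\<Sum>i<m. c i * (\<Sum>y<v. of_bool (E x y) * u i y))"
    unfolding sum_distrib_left by (subst sum.swap) (simp only: mult_ac)
  also have "\<dots> = (\<Sum>i<m. c i * (\<mu> * u i x))"
    using assms(1) x by (auto simp only: eigenfunction_def intro!: sum.cong)
  also have "\<dots> = \<mu> * (\<Sum>i<m. c i * u i x)" by (simp add: sum_distrib_left mult_ac)
  finally have comb: "(\<Sum>y<v. of_bool (E x y) * (\<Sum>i<m. c i * u i y)) = \<mu> * (\<Sum>i<m. c i * u i x)" .
  have "(\<Sum>y<v. of_bool (E x y) * (s * (w y - (\<Sum>i<m. c i * u i y)))) =
      s * ((\<Sum>y<v. of_bool (E x y) * w y) - (\<Sum>y<v. of_bool (E x y) * (\<Sum>i<m. c i * u i y)))"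
    unfolding sum_subtractf[symmetric] unfolding sum_distrib_left[of s]
    by (intro sum.cong) (simp_all only: algebra_simps)
  also have "\<dots> = s * (\<mu> * w x - \<mu> * (\<Sum>i<m. c i * u i x))"
    using assms(2) x by (simp only: comb eigenfunction_def)
  finally show "(\<Sum>y<v. of_bool (E x y) * (s * (w y - (\<Sum>i<m. c i * u i y)))) =
      \<mu> * (s * (w x - (\<Sum>i<m. c i * u i x)))"
    by (simp only: algebra_simps)
qed

text \<open>Reindexing the neighbour sum along g shows that the eigenspace is invariant under
  composition with automorphisms.\<close>

lemma eigenfunction_automorphism:
  assumes g: "g \<in> graph_automorphisms v E" and w: "eigenfunction v E \<mu> w"
  shows "eigenfunction v E \<mu> (\<lambda>x. w (g x))"
  unfolding eigenfunction_def
proof (intro allI impI)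
  fix x assume x: "x < v"
  have perm: "g permutes {..<v}" and auto: "\<And>y. y < v \<Longrightarrow> E (g x) (g y) = E x y"
    using g x by (auto simp: graph_automorphisms_def)
  have gx: "g x < v" using permutes_in_image[OF perm, of x] x by simp
  have "(\<Sum>y<v. of_bool (E x y) * w (g y)) = (\<Sum>y<v. of_bool (E (g x) (g y)) * w (g y))"
    using auto by (intro sum.cong) auto
  also have "\<dots> = (\<Sum>y<v. of_bool (E (g x) y) * w y)"
    using sum.permute[OF perm, of "\<lambda>y. of_bool (E (g x) y) * w y"] by (simp only: o_def)
  also have "\<dots> = \<mu> * w (g x)" using w gx by (simp only: eigenfunction_def)
  finally show "(\<Sum>y<v. of_bool (E x y) * w (g y)) = \<mu> * w (g x)" .
qed

section \<open>Orthonormal bases of eigenspaces\<close>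

definition orthonormal :: "nat \<Rightarrow> nat \<Rightarrow> (nat \<Rightarrow> nat \<Rightarrow> real) \<Rightarrow> bool" where
  "orthonormal v m u \<longleftrightarrow> (\<forall>i<m. \<forall>j<m. (\<Sum>x<v. u i x * u j x) = of_bool (i = j))"

lemma orthonormal_combination:
  assumes "orthonormal v m u" "j < m"
  shows "(\<Sum>x<v. (\<Sum>i<m. c i * u i x) * u j x) = c j"
proof -
  have "(\<Sum>x<v. (\<Sum>i<m. c i * u i x) * u j x) = (\<Sum>i<m. c i * (\<Sum>x<v. u i x * u j x))"
    unfolding sum_distrib_left sum_distrib_right by (subst sum.swap) (simp only: mult_ac)
  also have "\<dots> = (\<Sum>i<m. if i = j then c i else 0)"
    using assms by (intro sum.cong) (auto simp: orthonormal_def)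
  finally show ?thesis using assms(2) by simp
qed

lemma Bessel_inequality:
  assumes "orthonormal v m u"
  shows "(\<Sum>i<m. (\<Sum>x<v. f x * u i x)\<^sup>2) \<le> (\<Sum>x<v. (f x)\<^sup>2)"
proof -
  define c where "c i = (\<Sum>x<v. f x * u i x)" for i
  define p where "p x = (\<Sum>i<m. c i * u i x)" for x
  have fp: "(\<Sum>x<v. f x * p x) = (\<Sum>i<m. (c i)\<^sup>2)"
  proof -
    have "(\<Sum>x<v. f x * p x) = (\<Sum>i<m. c i * (\<Sum>x<v. f x * u i x))"
      unfolding p_def sum_distrib_left by (subst sum.swap) (simp only: mult_ac)
    then show ?thesis by (simp add: c_def power2_eq_square)
  qed
  have pp: "(\<Sum>x<v. p x * p x) = (\<Sum>i<m. (c i)\<^sup>2)"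
  proof -
    have "(\<Sum>x<v. p x * p x) = (\<Sum>x<v. \<Sum>i<m. c i * (p x * u i x))"
      unfolding p_def sum_distrib_left by (simp only: mult_ac)
    also have "\<dots> = (\<Sum>i<m. c i * (\<Sum>x<v. p x * u i x))"
      unfolding sum_distrib_left by (rule sum.swap)
    also have "\<dots> = (\<Sum>i<m. (c i)\<^sup>2)"
      unfolding p_def using orthonormal_combination[OF assms] by (simp add: power2_eq_square)
    finally show ?thesis .
  qed
  have "0 \<le> (\<Sum>x<v. (f x - p x)\<^sup>2)" by (intro sum_nonneg) auto
  also have "\<dots> = (\<Sum>x<v. (f x)\<^sup>2) - 2 * (\<Sum>x<v. f x * p x) + (\<Sum>x<v. p x * p x)"
    unfolding sum_distrib_left sum_subtractf[symmetric] sum.distrib[symmetric]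
    by (intro sum.cong) (auto simp: power2_eq_square algebra_simps)
  finally show ?thesis unfolding fp pp c_def by simp
qed

text \<open>The number \<mu> times \<open>u i x\<close> is the inner product of row x of the
  adjacency matrix with \<open>u i\<close>. Bessel's inequality for that row bounds the sum over i
  of the squares by k, and summing over x gives v k.\<close>

lemma eigenspace_dimension_bound:
  assumes reg: "regular_graph v E k" and on: "orthonormal v m u"
    and ef: "\<And>i. i < m \<Longrightarrow> eigenfunction v E \<mu> (u i)"
  shows "real m * \<mu>\<^sup>2 \<le> real v * real k"
proof -
  have "real m * \<mu>\<^sup>2 = (\<Sum>i<m. \<mu>\<^sup>2 * (\<Sum>x<v. u i x * u i x))"
    using on by (simp add: orthonormal_def)
  also have "\<dots> = (\<Sum>i<m. \<Sum>x<v. (\<mu> * u i x)\<^sup>2)"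
    unfolding sum_distrib_left by (simp add: power2_eq_square mult_ac)
  also have "\<dots> = (\<Sum>i<m. \<Sum>x<v. (\<Sum>y<v. of_bool (E x y) * u i y)\<^sup>2)"
  proof (intro sum.cong refl)
    fix i x assume "i \<in> {..<m}" "x \<in> {..<v}"
    then have "(\<Sum>y<v. of_bool (E x y) * u i y) = \<mu> * u i x"
      using ef by (auto simp only: eigenfunction_def)
    then show "(\<mu> * u i x)\<^sup>2 = (\<Sum>y<v. of_bool (E x y) * u i y)\<^sup>2" by (simp only:)
  qed
  also have "\<dots> = (\<Sum>x<v. \<Sum>i<m. (\<Sum>y<v. of_bool (E x y) * u i y)\<^sup>2)" by (rule sum.swap)
  also have "\<dots> \<le> (\<Sum>x<v. \<Sum>y<v. (of_bool (E x y))\<^sup>2)"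
    by (intro sum_mono Bessel_inequality[OF on])
  also have "\<dots> = (\<Sum>x<v. real k)"
    using regular_row_sum[OF reg] by (intro sum.cong) (auto simp: power2_eq_square)
  finally show ?thesis by simp
qed

text \<open>For nonzero \<mu> the dimension bound limits the size of orthonormal systems of
  eigenfunctions, so a largest one exists. It spans, since otherwise a normalised residual would
  enlarge it.\<close>

lemma eigenspace_orthonormal_basis:
  assumes reg: "regular_graph v E k" and nz: "\<mu> \<noteq> 0"
  obtains m u where "orthonormal v m u" "\<And>i. i < m \<Longrightarrow> eigenfunction v E \<mu> (u i)"
    "\<And>w x. eigenfunction v E \<mu> w \<Longrightarrow> x < v \<Longrightarrow> w x = (\<Sum>i<m. (\<Sum>y<v. w y * u i y) * u i x)"
proof -
  let ?good = "\<lambda>m. \<exists>u. orthonormal v m u \<and> (\<forall>i<m. eigenfunction v E \<mu> (u i))"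
  have bound: "m \<le> nat \<lceil>real v * real k / \<mu>\<^sup>2\<rceil>" if good: "?good m" for m
  proof -
    obtain u where "orthonormal v m u" "\<And>i. i < m \<Longrightarrow> eigenfunction v E \<mu> (u i)"
      using good by blast
    then have "real m * \<mu>\<^sup>2 \<le> real v * real k" by (rule eigenspace_dimension_bound[OF reg])
    then have "real m \<le> real v * real k / \<mu>\<^sup>2" using nz by (simp add: field_simps)
    then show ?thesis by linarith
  qed
  have "?good 0" by (simp add: orthonormal_def)
  define m where "m = (GREATEST m. ?good m)"
  have "?good m" unfolding m_def using \<open>?good 0\<close> bound by (rule GreatestI_nat)
  then obtain u where on: "orthonormal v m u" and ef: "\<And>i. i < m \<Longrightarrow> eigenfunction v E \<mu> (u i)"
    by blast
  have max: "\<not> ?good (Suc m)"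
  proof
    assume "?good (Suc m)"
    then have "Suc m \<le> m" unfolding m_def using bound by (rule Greatest_le_nat)
    then show False by simp
  qed
  have "w x = (\<Sum>i<m. (\<Sum>y<v. w y * u i y) * u i x)"
    if w: "eigenfunction v E \<mu> w" and x: "x < v" for w x
  proof (rule ccontr)
    define c where "c i = (\<Sum>y<v. w y * u i y)" for i
    \<comment> \<open>The residual of w after projection is orthogonal to all \<open>u i\<close>;
      below, s is its squared norm.\<close>
    define r where "r x = w x - (\<Sum>i<m. c i * u i x)" for x
    assume "w x \<noteq> (\<Sum>i<m. (\<Sum>y<v. w y * u i y) * u i x)"
    then have "r x \<noteq> 0" by (simp add: r_def c_def)
    define s where "s = (\<Sum>x<v. r x * r x)"
    have "s > 0" unfolding s_def
      using x \<open>r x \<noteq> 0\<close> by (intro sum_pos2[of _ x]) (auto simp: zero_less_mult_iff)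
    define u' where "u' = u(m := (\<lambda>x. 1 / sqrt s * r x))"
    have orth: "(\<Sum>x<v. r x * u j x) = 0" if "j < m" for j
      using orthonormal_combination[OF on that, of c]
      by (simp add: r_def left_diff_distrib sum_subtractf c_def)
    have orth': "(\<Sum>x<v. u j x * r x) = 0" if "j < m" for j
      using orth[OF that] by (simp add: mult.commute)
    have "(\<Sum>x<v. (1 / sqrt s * r x) * (1 / sqrt s * r x)) = 1 / sqrt s * (1 / sqrt s) * s"
      unfolding s_def sum_distrib_left by (intro sum.cong) (simp_all only: mult_ac)
    also have "\<dots> = 1" using \<open>s > 0\<close> by simp
    finally have unit: "(\<Sum>x<v. (1 / sqrt s * r x) * (1 / sqrt s * r x)) = 1" .
    have "orthonormal v (Suc m) u'"
      unfolding orthonormal_def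
    proof (intro allI impI)
      fix i j assume "i < Suc m" "j < Suc m"
      then consider "i < m" "j < m" | "i = m" "j < m" | "i < m" "j = m" | "i = m" "j = m"
        by linarith
      then show "(\<Sum>x<v. u' i x * u' j x) = of_bool (i = j)"
      proof cases
        case 1
        then show ?thesis using on by (simp add: u'_def orthonormal_def)
      next
        case 2
        have "(\<Sum>x<v. u' i x * u' j x) = 1 / sqrt s * (\<Sum>x<v. r x * u j x)"
          using 2 by (simp add: u'_def sum_distrib_left)
        then show ?thesis using 2 orth by simp
      next
        case 3
        have "(\<Sum>x<v. u' i x * u' j x) = 1 / sqrt s * (\<Sum>x<v. u i x * r x)"
          using 3 by (simp add: u'_def sum_distrib_left)
        then show ?thesis using 3 orth' by simp
      next
        case 4
        then show ?thesis using unit by (simp add: u'_def)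
      qed
    qed
    moreover have "eigenfunction v E \<mu> (u' i)" if "i < Suc m" for i
      using that ef eigenfunction_linear_combination[of m v E \<mu> u w "1 / sqrt s" c] w
      by (cases "i = m") (auto simp: u'_def r_def)
    ultimately show False using max by blast
  qed
  then show ?thesis using that on ef by blast
qed

section \<open>The action on an eigenspace\<close>

lemma permutation_group_automorphisms:
  "permutation_group (graph_automorphisms v E) {..<v}"
proof
  fix g h assume g: "g \<in> graph_automorphisms v E" and h: "h \<in> graph_automorphisms v E"
  have lt: "p x < v \<longleftrightarrow> x < v" if "p permutes {..<v}" for p x
    using permutes_in_image[OF that, of x] by simp
  show "g permutes {..<v}" using g by (simp add: graph_automorphisms_def)
  show "g \<circ> h \<in> graph_automorphisms v E"
    using g h by (auto simp: graph_automorphisms_def permutes_compose lt)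
  show "pinv g \<in> graph_automorphisms v E"
    unfolding graph_automorphisms_def
  proof (intro CollectI conjI allI impI)
    have perm: "g permutes {..<v}" using g by (simp add: graph_automorphisms_def)
    then show inv: "pinv g permutes {..<v}" by (rule permutes_inv)
    fix x y assume "x < v" "y < v"
    then have "pinv g x < v" "pinv g y < v" using lt[OF inv] by auto
    then have "E (g (pinv g x)) (g (pinv g y)) = E (pinv g x) (pinv g y)"
      using g by (simp add: graph_automorphisms_def)
    then show "E (pinv g x) (pinv g y) = E x y" using permutes_inverses(1)[OF perm] by simp
  qed
qed (auto simp: graph_automorphisms_def permutes_id)

section \<open>Transfer to the group \<open>Aut\<close> and the index bound\<close>

lemma group_Aut: "group (Aut v E)"
proof -
  interpret permutation_group "graph_automorphisms v E" "{..<v}"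
    by (rule permutation_group_automorphisms)
  show ?thesis
  proof (rule groupI)
    fix g assume g: "g \<in> carrier (Aut v E)"
    then show "\<exists>h\<in>carrier (Aut v E). h \<otimes>\<^bsub>Aut v E\<^esub> g = \<one>\<^bsub>Aut v E\<^esub>"
      using inv_closed[of g] comp_inv(2)[of g] by (auto simp: Aut_def)
  qed (auto simp: Aut_def id_closed comp_closed comp_assoc)
qed

text \<open>As A is one of finitely many abelian normal subgroups, the maximum in the definition of
  the index is at least its cardinality.\<close>

lemma index_largest_abelian_normal_le:
  assumes A: "permutation_group.normal_in (graph_automorphisms v E) A"
    and comm: "\<And>a b. a \<in> A \<Longrightarrow> b \<in> A \<Longrightarrow> a \<circ> b = b \<circ> a"
    and card: "card (graph_automorphisms v E) \<le> B * card A"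
  shows "index_largest_abelian_normal (Aut v E) \<le> B"
proof -
  interpret permutation_group "graph_automorphisms v E" "{..<v}"
    by (rule permutation_group_automorphisms)
  interpret G: group "Aut v E" by (rule group_Aut)
  have inv: "inv\<^bsub>Aut v E\<^esub> g = pinv g" if "g \<in> graph_automorphisms v E" for g
    using that inv_closed[OF that] comp_inv(2)[OF that]
    by (intro G.inv_equality) (auto simp: Aut_def)
  have AP: "A \<subseteq> graph_automorphisms v E" using A by (simp add: normal_in_def)
  have "subgroup A (Aut v E)"
  proof (rule G.subgroupI)
    fix a assume "a \<in> A"
    then show "inv\<^bsub>Aut v E\<^esub> a \<in> A" using A AP inv[of a] by (auto simp: normal_in_def)
  qed (use A in \<open>auto simp: normal_in_def Aut_def\<close>)
  then have "A \<lhd> Aut v E"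
    unfolding G.normal_inv_iff using A inv by (auto simp: normal_in_def Aut_def)
  then have abn: "abelian_normal_subgroup (Aut v E) A"
    using comm by (simp add: abelian_normal_subgroup_def Aut_def)
  have "{A. abelian_normal_subgroup (Aut v E) A} \<subseteq> Pow (graph_automorphisms v E)"
    using subgroup.subset[OF normal.axioms(1)]
    by (fastforce simp: abelian_normal_subgroup_def Aut_def)
  then have "finite {A. abelian_normal_subgroup (Aut v E) A}"
    using finite_group finite_subset by blast
  then have le: "card A \<le> Max (card ` {A. abelian_normal_subgroup (Aut v E) A})" (is "_ \<le> ?M")
    using abn by (intro Max_ge) auto
  have "id \<in> A" "finite A" using A finite_subset[OF AP finite_group] by (auto simp: normal_in_def)
  then have "card A > 0" by (auto simp: card_gt_0_iff)
  have "order (Aut v E) \<le> B * card A" using card by (simp add: order_def Aut_def)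
  also have "\<dots> \<le> B * ?M" using le by simp
  finally have "order (Aut v E) div ?M \<le> B * ?M div ?M" by (rule div_le_mono)
  then show ?thesis using le \<open>card A > 0\<close> by (simp add: index_largest_abelian_normal_def)
qed

text \<open>This is the quantitative contrapositive for a single graph: a large second eigenvalue
  forces an index bounded in terms of d alone, and d depends only on c and \<epsilon>.\<close>

lemma index_bound:
  assumes graph: "simple_graph v E" and reg: "regular_graph v E k"
    and prim: "primitive_on (carrier (Aut v E)) {..<v}"
    and large: "\<bar>Lambda v E\<bar> > c * real k" and c: "c > 0" and dense: "real k > \<epsilon> * real v"
    and eps: "\<epsilon> > 0" and d: "1 / (c\<^sup>2 * \<epsilon>) \<le> real d"
  shows "index_largest_abelian_normal (Aut v E) \<le> (4 * d + 3) ^ (d * d)"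
proof -
  let ?P = "graph_automorphisms v E"
  interpret permutation_group ?P "{..<v}" by (rule permutation_group_automorphisms)
  have k: "k > 0" using dense eps by (smt (verit) mult_nonneg_nonneg of_nat_0_le_iff of_nat_0_less_iff)
  have prim': "primitive_on ?P {..<v}" using prim by (simp add: Aut_def)
  have "c * real k > 0" using c k by simp
  then have "Lambda v E \<noteq> 0" using large by auto
  then obtain \<mu> w where \<mu>: "\<bar>\<mu>\<bar> = \<bar>Lambda v E\<bar>" and w: "eigenfunction v E \<mu> w"
    and nonconst: "\<exists>x<v. \<exists>y<v. w x \<noteq> w y"
    using Lambda_eigenfunction[OF graph reg] by blast
  have \<mu>0: "\<mu> \<noteq> 0" using \<mu> \<open>Lambda v E \<noteq> 0\<close> by auto
  obtain m u where on: "orthonormal v m u" and ef: "\<And>i. i < m \<Longrightarrow> eigenfunction v E \<mu> (u i)"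
    and span: "\<And>w x. eigenfunction v E \<mu> w \<Longrightarrow> x < v \<Longrightarrow>
      w x = (\<Sum>i<m. (\<Sum>y<v. w y * u i y) * u i x)"
    using eigenspace_orthonormal_basis[OF reg \<mu>0] by blast
  \<comment> \<open>With \<mu> of modulus at least c k, the dimension bound gives m c^2 k^2 <= v k,
    and density bounds v by k / \<epsilon>; hence m <= 1 / (c^2 \<epsilon>) <= d.\<close>
  have "real m * (c * real k)\<^sup>2 \<le> real m * \<mu>\<^sup>2"
  proof -
    have "\<bar>c * real k\<bar> \<le> \<bar>\<mu>\<bar>" using large \<mu> c by simp
    then show ?thesis by (intro mult_left_mono) (simp_all add: abs_le_square_iff)
  qed
  also have "\<dots> \<le> real v * real k" by (rule eigenspace_dimension_bound[OF reg on ef])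
  finally have "real k * (real m * c\<^sup>2 * real k) \<le> real k * real v"
    by (simp add: power2_eq_square mult_ac)
  then have "real m * c\<^sup>2 * real k \<le> real v" using k by simp
  also have "\<dots> \<le> real k / \<epsilon>" using dense eps by (simp add: field_simps)
  finally have "real k * (real m * c\<^sup>2 * \<epsilon>) \<le> real k * 1" using eps by (simp add: field_simps)
  then have "real m * (c\<^sup>2 * \<epsilon>) \<le> 1" using k by (simp add: mult_ac)
  then have "real m \<le> 1 / (c\<^sup>2 * \<epsilon>)" using c eps by (simp add: field_simps)
  then have md: "m \<le> d" using d by linarith

  \<comment> \<open>Row i holds the coordinates of \<open>u i\<close> composed with g. Composition
    on the right reverses products, and placing coordinates in rows rather than columns reverses
    them again, so \<open>\<rho>\<close> is a homomorphism.\<close>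
  define \<rho> where "\<rho> g = mat m m (\<lambda>(i, j). \<Sum>x<v. u i (g x) * u j x)" for g
  have expand: "u i (g x) = (\<Sum>j<m. \<rho> g $$ (i, j) * u j x)" if "g \<in> ?P" "i < m" "x < v" for g i x
    using span[OF eigenfunction_automorphism[OF that(1) ef[OF that(2)]] that(3)] that(2)
    by (simp add: \<rho>_def)
  have lt: "g x < v" if "g \<in> ?P" "x < v" for g x using in_domain_iff[OF that(1), of x] that by simp
  interpret orthogonal_representation ?P "{..<v}" m \<rho>
  proof
    fix g assume g: "g \<in> ?P"
    show "\<rho> g \<in> carrier_mat m m" by (simp add: \<rho>_def)
    show "\<rho> (pinv g) = transpose_mat (\<rho> g)"
    proof (rule eq_matI)
      fix i j assume "i < dim_row (transpose_mat (\<rho> g))" "j < dim_col (transpose_mat (\<rho> g))"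
      then have ij: "i < m" "j < m" by (auto simp: \<rho>_def)
      \<comment> \<open>Reindexing along g moves the permutation to the other factor, which is the
        orthogonality of the action.\<close>
      have "(\<Sum>x<v. u i (pinv g x) * u j x) = (\<Sum>x<v. u j (g x) * u i x)"
        using sum.permute[OF permutes[OF g], of "\<lambda>x. u i (pinv g x) * u j x"] g
        by (simp add: o_def mult.commute)
      then show "\<rho> (pinv g) $$ (i, j) = transpose_mat (\<rho> g) $$ (i, j)"
        using ij by (simp add: \<rho>_def)
    qed (auto simp: \<rho>_def)
    {
      fix h assume h: "h \<in> ?P"
      show "\<rho> (g \<circ> h) = \<rho> g * \<rho> h"
      proof (rule eq_matI)
        fix i j assume "i < dim_row (\<rho> g * \<rho> h)" "j < dim_col (\<rho> g * \<rho> h)"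
        then have ij: "i < m" "j < m" by (auto simp: \<rho>_def)
        have "\<rho> (g \<circ> h) $$ (i, j) = (\<Sum>x<v. (\<Sum>l<m. \<rho> g $$ (i, l) * u l (h x)) * u j x)"
          using ij lt[OF h] expand[OF g] by (simp add: \<rho>_def[of "g \<circ> h"])
        also have "\<dots> = (\<Sum>l<m. \<rho> g $$ (i, l) * (\<Sum>x<v. u l (h x) * u j x))"
          unfolding sum_distrib_left sum_distrib_right by (subst sum.swap) (simp only: mult_ac)
        also have "\<dots> = (\<Sum>l<m. \<rho> g $$ (i, l) * \<rho> h $$ (l, j))"
          using ij by (simp add: \<rho>_def[of h])
        also have "\<dots> = (\<rho> g * \<rho> h) $$ (i, j)"
          using ij by (simp add: \<rho>_def scalar_prod_def atLeast0LessThan)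
        finally show "\<rho> (g \<circ> h) $$ (i, j) = (\<rho> g * \<rho> h) $$ (i, j)" .
      qed (auto simp: \<rho>_def)
    }
    assume one: "\<rho> g = 1\<^sub>m m"
    show "g = id"
    proof (rule ccontr)
      assume "g \<noteq> id"
      \<comment> \<open>\<open>N\<close> is the kernel of the action on the eigenspace. If g were a
        nontrivial element of it, \<open>N\<close> would be transitive and every eigenfunction, w
        included, would be constant.\<close>
      define N where "N = {h \<in> ?P. \<forall>f. eigenfunction v E \<mu> f \<longrightarrow> (\<forall>x<v. f (h x) = f x)}"
      have N_fix: "f (h x) = f x" if "h \<in> N" "eigenfunction v E \<mu> f" "x < v" for h f x
        using that by (simp add: N_def)
      have uN: "u i (g x) = u i x" if "i < m" "x < v" for i x
      proof -
        have "u i (g x) = (\<Sum>j<m. if i = j then u j x else 0)"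
          unfolding expand[OF g that] one using that by (intro sum.cong) auto
        then show ?thesis using that by simp
      qed
      have "f (g x) = f x" if "eigenfunction v E \<mu> f" "x < v" for f x
        using span[OF that(1) lt[OF g that(2)]] span[OF that] uN that by simp
      then have "g \<in> N" using g by (simp add: N_def)
      have "normal_in N"
        unfolding normal_in_def
      proof (intro conjI ballI)
        show "N \<subseteq> ?P" by (auto simp: N_def)
        show "id \<in> N" using id_closed by (simp add: N_def)
        fix a assume a: "a \<in> N"
        then have aP: "a \<in> ?P" by (simp add: N_def)
        show "a \<circ> b \<in> N" if "b \<in> N" for b
          using a that lt comp_closed by (auto simp: N_def)
        have "f (pinv a x) = f x" if "eigenfunction v E \<mu> f" "x < v" for f x
        proof -
          have "f (a (pinv a x)) = f (pinv a x)"
            using N_fix[OF a that(1) lt[OF inv_closed[OF aP] that(2)]] .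
          then show ?thesis using aP by simp
        qed
        then show "pinv a \<in> N" using inv_closed[OF aP] by (simp add: N_def)
        fix h assume h: "h \<in> ?P"
        have "f (h (a (pinv h x))) = f x" if "eigenfunction v E \<mu> f" "x < v" for f x
        proof -
          have "f (h (a (pinv h x))) = f (h (pinv h x))"
            using N_fix[OF a eigenfunction_automorphism[OF h that(1)] lt[OF inv_closed[OF h] that(2)]] .
          then show ?thesis using h by simp
        qed
        then show "h \<circ> a \<circ> pinv h \<in> N"
          using comp_closed[OF comp_closed[OF h aP] inv_closed[OF h]] by (simp add: N_def)
      qed
      then have "transitive_on N {..<v}"
        using primitive_normal_transitive[OF prim'] \<open>g \<in> N\<close> \<open>g \<noteq> id\<close> by blast
      then have "w x = w y" if "x < v" "y < v" for x y
        using that N_fix[OF _ w] unfolding transitive_on_def by (metis lessThan_iff)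
      then show False using nonconst by blast
    qed
  next
    show "\<rho> id = 1\<^sub>m m"
      using on by (intro eq_matI) (auto simp: \<rho>_def orthonormal_def)
  qed
  obtain A where "normal_in A" "\<And>a b. a \<in> A \<Longrightarrow> b \<in> A \<Longrightarrow> a \<circ> b = b \<circ> a"
    "card ?P \<le> (4 * m + 3) ^ (m * m) * card A"
    using abelian_normal_small_index[OF prim'] by blast
  then have "index_largest_abelian_normal (Aut v E) \<le> (4 * m + 3) ^ (m * m)"
    by (rule index_largest_abelian_normal_le)
  also have "\<dots> \<le> (4 * d + 3) ^ (m * m)" using md by (intro power_mono) auto
  also have "\<dots> \<le> (4 * d + 3) ^ (d * d)" using md by (intro power_increasing mult_mono) auto
  finally show ?thesis .
qed

theorem theorem0p5:
  fixes \<epsilon> :: real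
    and v k :: "nat \<Rightarrow> nat"
    and E :: "nat \<Rightarrow> nat \<Rightarrow> nat \<Rightarrow> bool"
  assumes eps: "\<epsilon> > 0"
    and graph: "\<And>n. simple_graph (v n) (E n)"
    and reg: "\<And>n. regular_graph (v n) (E n) (k n)"
    and dense: "\<And>n. real (k n) > \<epsilon> * real (v n)"
    and prim: "\<And>n. primitive_on (carrier (Aut (v n) (E n))) {..<v n}"
    and idx: "filterlim (\<lambda>n. index_largest_abelian_normal (Aut (v n) (E n))) at_top sequentially"
  shows "(\<lambda>n. Lambda (v n) (E n)) \<in> o(\<lambda>n. real (k n))"
proof (rule landau_o.smallI)
  fix c :: real assume c: "c > 0"
  \<comment> \<open>The choice of d depends on c and \<epsilon> but not on n, so the index bound it
    yields is a constant that the indices eventually exceed.\<close>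
  obtain d :: nat where d: "1 / (c\<^sup>2 * \<epsilon>) \<le> real d" using real_arch_simple by blast
  have "\<forall>\<^sub>F n in sequentially.
      (4 * d + 3) ^ (d * d) < index_largest_abelian_normal (Aut (v n) (E n))"
    by (rule eventually_compose_filterlim[OF eventually_gt_at_top idx])
  then show "\<forall>\<^sub>F n in sequentially. norm (Lambda (v n) (E n)) \<le> c * norm (real (k n))"
  proof eventually_elim
    case (elim n)
    then have "\<not> \<bar>Lambda (v n) (E n)\<bar> > c * real (k n)"
      using index_bound[OF graph reg prim _ c dense eps d, of n] by linarith
    then show ?case by simp
  qed
qed

end
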